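(* Let $n$ be a positive integer. Let $b_1,\dots,b_n$ be nonzero complex numbers such that $b_{n+1-i}=\overline{b_i}$ for all $i=1,\dots,n$. Let $z_1,\dots,z_n$ be distinct complex numbers with $|z_i|=1$ and $z_i\neq 1$ for all $i$, such that $z_{n+1-i}=\overline{z_i}$ for all $i=1,\dots,n$. Assume in addition that $z_i\ne -1$ for all $i$ and that none of the ratios $z_j/z_i$ with $i\neq j$ is a root of unity. Then $$\inf_{k\in\mathbb{Z}}\sum_{j=1}^n b_jz_j^k<-\frac{1}{\pi^4}\Bigl(\min_{1\le j\le n}|b_j|\Bigr)\log n.$$
   Context: The sum $\sum_{j=1}^n b_jz_j^k$ is real for every integer $k$ because of the conjugacy conditions. $\log$ is the natural logarithm. *)

theory Defs
  imports Complex_Main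
begin

definition root_of_unity :: "complex \<Rightarrow> bool" where
  "root_of_unity w \<longleftrightarrow> (\<exists>m::nat. m > 0 \<and> w ^ m = 1)"

definition power_sum :: "nat \<Rightarrow> (nat \<Rightarrow> complex) \<Rightarrow> (nat \<Rightarrow> complex) \<Rightarrow> int \<Rightarrow> complex" where
  "power_sum n b z k = (\<Sum>j=1..n. b j * z j powi k)"

text \<open>
  Under the conjugacy conditions the power sums are real, so taking the real part of
  \<^term>\<open>power_sum n b z k\<close> loses nothing; for \<^term>\<open>z\<close> on the unit circle they are also bounded,
  so their infimum over all integers \<^term>\<open>k\<close> in the conditionally complete lattice of the
  reals is the genuine one.
\<close>

lemma power_sum_in_Reals:
  assumes "\<And>i. i \<in> {1..n} \<Longrightarrow> b (n + 1 - i) = cnj (b i)"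
    and "\<And>i. i \<in> {1..n} \<Longrightarrow> z (n + 1 - i) = cnj (z i)"
  shows "power_sum n b z k \<in> \<real>"
proof -
  have cnj_powi: "cnj (w powi k) = cnj w powi k" for w
    by (simp add: power_int_def)
  have "cnj (power_sum n b z k) = (\<Sum>j=1..n. b (n + 1 - j) * z (n + 1 - j) powi k)"
    unfolding power_sum_def cnj_sum using assms by (intro sum.cong) (auto simp: cnj_powi)
  also have "\<dots> = power_sum n b z k"
    unfolding power_sum_def
    by (rule sum.reindex_bij_witness[of _ "\<lambda>j. n + 1 - j" "\<lambda>j. n + 1 - j"]) auto
  finally show ?thesis
    by (simp add: Reals_cnj_iff)
qed

lemma bdd_below_power_sum:
  assumes "\<And>i. i \<in> {1..n} \<Longrightarrow> cmod (z i) = 1"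
  shows "bdd_below (range (\<lambda>k. Re (power_sum n b z k)))"
proof (rule bdd_belowI2)
  fix k
  have "cmod (power_sum n b z k) \<le> (\<Sum>j=1..n. cmod (b j))"
    unfolding power_sum_def using assms
    by (intro sum_norm_le) (auto simp: norm_mult norm_power_int)
  then show "- (\<Sum>j=1..n. cmod (b j)) \<le> Re (power_sum n b z k)"
    using abs_Re_le_cmod[of "power_sum n b z k"] by linarith
qed

end

theory Submission
  imports Defs "HOL-Analysis.Analysis"
begin

text \<open>
  The power sums \<open>S(k) = (\<Sum>j. b j * z j ^ k)\<close> have mean value zero over \<open>k\<close>, so if they are bounded
  below by \<open>- M\<close> then their mean absolute value is at most \<open>2 * M\<close>.  Littlewood's conjecture, proved
  by Konyagin and by McGehee, Pigno and Smith, says that an exponential sum with \<open>n\<close> distinct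
  integer frequencies and coefficients of modulus at least \<open>\<beta>\<close> has mean absolute value at least a
  constant times \<open>\<beta> * ln n\<close>.  The two facts together bound \<open>M\<close> from below, and the method of
  McGehee, Pigno and Smith yields a constant well above what is needed.

  The passage from the \<open>z j\<close> to integer frequencies is Kronecker's approximation theorem.  Write
  \<open>z j = cis (2 * pi * \<theta> j)\<close> and choose real numbers, one of them \<open>1\<close>, that are linearly independent
  over the integers and have integer combinations equal to \<open>D * \<theta> j\<close> for a common \<open>D > 0\<close>.  By
  Kronecker, multiples of the basis elements other than \<open>1\<close> come arbitrarily close modulo \<open>1\<close> to
  any prescribed values; the choice \<open>N ^ i * t\<close> for the \<open>i\<close>-th of them brings \<open>z j ^ (k * D)\<close>, for
  suitable \<open>k\<close>, close to \<open>cis (2 * pi * m j * t)\<close> for all \<open>j\<close> at once, with \<open>m j\<close> the value at \<open>N\<close>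
  of a polynomial whose coefficients are the coordinates of \<open>D * \<theta> j\<close>.  For suitable \<open>N\<close>, equality
  of \<open>m i\<close> and \<open>m j\<close> forces \<open>z i / z j\<close> to be a root of unity (\<open>powers_approximate_characters\<close>).  Consequently the
  trigonometric polynomial \<open>p(t) = (\<Sum>j. b j * cis (2 * pi * m j * t))\<close> has distinct nonzero
  frequencies, and each of its values is a limit of power sums: it is real and at least the infimum.

  For such \<open>p\<close> the bound is a duality argument (\<open>trig_poly_min_bound\<close>).  The frequencies are listed
  in increasing order and cut into consecutive blocks of \<open>1, 4, 16, \<dots>\<close> elements.  There is a
  function \<open>F\<close> with modulus at most \<open>5\<close> whose Fourier coefficients on the \<open>j\<close>-th block have size at least
  \<open>1 / (2 * 4 ^ j)\<close> in the direction of the coefficients of \<open>p\<close> and which vanish above all blocks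
  (\<open>dual_function\<close>).  So the pairing of \<open>p\<close> with \<open>F\<close> gains \<open>\<beta> / 2\<close> from every block, while
  positivity of \<open>p + M\<close> bounds it by \<open>10 * M\<close>.  The number of blocks is comparable to \<open>ln n\<close>.

  The function \<open>F\<close> is built block by block.  The plain sum of the natural test functions \<open>f i\<close>
  of the blocks has no bound independent of their number, so before \<open>f i\<close> is added the partial sum
  is damped by the factor \<open>exp (- h i / 4)\<close>, where the real part of \<open>h i\<close> dominates the modulus of \<open>f i\<close>.  If \<open>h i\<close> has only
  frequencies \<open>\<le> 0\<close>, then so has the damping factor, and it disturbs a block only through the later
  blocks, whose effect decays geometrically.
\<close>

section \<open>Trigonometric polynomials and their mean values\<close>

definition character :: "int \<Rightarrow> real \<Rightarrow> complex" where
  "character m t = cis (2 * pi * of_int m * t)"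

abbreviation mean :: "(real \<Rightarrow> 'a::euclidean_space) \<Rightarrow> 'a" where
  "mean g \<equiv> integral {0..1} g"

lemma character_0 [simp]: "character 0 t = 1"
  and norm_character [simp]: "cmod (character m t) = 1"
  and cnj_character: "cnj (character m t) = character (- m) t"
  and character_mult: "character m t * character l t = character (m + l) t"
  by (auto simp: character_def cis_cnj cis_mult algebra_simps)

lemma continuous_on_character [continuous_intros]: "continuous_on A (character m)"
  unfolding character_def cis_conv_exp by (intro continuous_intros)

lemma mean_character: "mean (character m) = (if m = 0 then 1 else 0)"
proof (cases "m = 0")
  case False
  have eq: "character m = (\<lambda>t. exp ((2 * pi * of_int m * \<i>) * complex_of_real t))"
    by (auto simp: character_def cis_conv_exp mult_ac)
  have "exp (2 * complex_of_real pi * of_int m * \<i>) = 1"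
    using exp_integer_2pi[of "of_int m"] by (simp add: mult_ac)
  then show ?thesis
    using False integral_exp[of 1 "2 * pi * of_int m * \<i>"] by (simp add: eq)
next
  case True
  then have "character m = (\<lambda>t. 1)" by auto
  with True show ?thesis by simp
qed

text \<open>
  The parameter is a set that contains the frequencies.  An induction principle is all that is
  needed of a trigonometric polynomial, whence the inductive form.
\<close>

inductive trig_poly :: "int set \<Rightarrow> (real \<Rightarrow> complex) \<Rightarrow> bool" for S where
  monom: "m \<in> S \<Longrightarrow> trig_poly S (\<lambda>t. c * character m t)"
| zero: "trig_poly S (\<lambda>t. 0)"
| add: "trig_poly S f \<Longrightarrow> trig_poly S g \<Longrightarrow> trig_poly S (\<lambda>t. f t + g t)"

lemma trig_poly_continuous: "trig_poly S f \<Longrightarrow> continuous_on A f"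
  by (induction rule: trig_poly.induct) (auto intro!: continuous_intros)

lemma trig_poly_mono: "trig_poly S f \<Longrightarrow> S \<subseteq> T \<Longrightarrow> trig_poly T f"
  by (induction rule: trig_poly.induct) (auto intro: trig_poly.intros)

lemma trig_poly_const: "0 \<in> S \<Longrightarrow> trig_poly S (\<lambda>t. c)"
  using trig_poly.monom[of 0 S c] by simp

lemma trig_poly_sum:
  "(\<And>i. i \<in> I \<Longrightarrow> trig_poly S (f i)) \<Longrightarrow> trig_poly S (\<lambda>t. \<Sum>i\<in>I. f i t)"
  by (induction I rule: infinite_finite_induct) (auto intro: trig_poly.intros)

lemma trig_poly_mult:
  assumes "trig_poly S f" "trig_poly T g" "\<And>a b. a \<in> S \<Longrightarrow> b \<in> T \<Longrightarrow> a + b \<in> U"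
  shows "trig_poly U (\<lambda>t. f t * g t)"
  using assms(1)
proof (induction rule: trig_poly.induct)
  case (monom m c)
  from assms(2) show ?case
  proof (induction rule: trig_poly.induct)
    case (monom l d)
    have "trig_poly U (\<lambda>t. (c * d) * character (m + l) t)"
      using assms(3) \<open>m \<in> S\<close> monom by (intro trig_poly.monom) auto
    moreover have "(\<lambda>t. (c * d) * character (m + l) t) = (\<lambda>t. c * character m t * (d * character l t))"
      by (auto simp: character_mult[symmetric])
    ultimately show ?case by simp
  qed (auto simp: distrib_left intro: trig_poly.intros)
qed (auto simp: distrib_right intro: trig_poly.intros)

lemma trig_poly_cmult: "trig_poly S f \<Longrightarrow> trig_poly S (\<lambda>t. c * f t)"
  using trig_poly_mult[of "{0}" "\<lambda>t. c" S f S] by (auto intro: trig_poly_const)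

lemma trig_poly_power:
  assumes "trig_poly S f" "0 \<in> S" "\<And>a b. a \<in> S \<Longrightarrow> b \<in> S \<Longrightarrow> a + b \<in> S"
  shows "trig_poly S (\<lambda>t. f t ^ n)"
  by (induction n) (use assms in \<open>auto intro: trig_poly_const trig_poly_mult\<close>)

lemma trig_poly_cnj: "trig_poly UNIV f \<Longrightarrow> trig_poly UNIV (\<lambda>t. cnj (f t))"
  by (induction rule: trig_poly.induct) (auto simp: cnj_character intro: trig_poly.intros)

lemma mean_trig_poly_eq_0:
  assumes "trig_poly S f" "0 \<notin> S"
  shows "mean f = 0"
  using assms(1)
proof (induction rule: trig_poly.induct)
  case (monom m c)
  then have "m \<noteq> 0" using assms(2) by auto
  then show ?case by (simp add: mean_character)
next
  case (add f g)
  then show ?case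
    by (simp add: integral_add integrable_continuous_interval trig_poly_continuous)
qed auto

text \<open>
  A power series in a polynomial with frequencies \<open>\<le> 0\<close> still has only frequencies \<open>\<le> 0\<close>: the
  partial sums of the exponential series are trigonometric polynomials, and they converge
  uniformly.
\<close>

lemma mean_trig_poly_mult_exp:
  assumes T: "trig_poly {..<0} T" and h: "trig_poly {..0} h"
  shows "mean (\<lambda>t. T t * exp (h t)) = 0"
proof -
  have bnd: "\<exists>B. \<forall>t\<in>{0..1}. cmod (f t) \<le> B" if "trig_poly S f" for S f
    using compact_imp_bounded[OF compact_continuous_image[OF trig_poly_continuous[OF that, of "{0..1}"]]]
    by (auto simp: bounded_iff)
  obtain B where B: "\<And>t. t \<in> {0..1} \<Longrightarrow> cmod (h t) \<le> B" using bnd[OF h] by blast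
  obtain K where K: "\<And>t. t \<in> {0..1} \<Longrightarrow> cmod (T t) \<le> K" using bnd[OF T] by blast
  define p where "p = (\<lambda>n t. T t * (h t ^ n /\<^sub>R fact n))"
  have p: "trig_poly {..<0} (p n)" for n
  proof -
    have "trig_poly {..<0} (\<lambda>t. T t * (complex_of_real (inverse (fact n)) * h t ^ n))"
      by (intro trig_poly_mult[OF T, of "{..0}"] trig_poly_cmult trig_poly_power h) auto
    then show ?thesis by (simp add: p_def scaleR_conv_of_real)
  qed
  have "uniform_limit {0..1} (\<lambda>n t. \<Sum>i<n. p i t) (\<lambda>t. suminf (\<lambda>i. p i t)) sequentially"
  proof (rule Weierstrass_m_test)
    fix n t assume t: "t \<in> {0..1::real}"
    have "cmod (T t) * (cmod (h t) ^ n /\<^sub>R fact n) \<le> K * (B ^ n /\<^sub>R fact n)"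
      using K[OF t] B[OF t] order_trans[OF norm_ge_zero K[OF t]]
      by (intro mult_mono scaleR_mono power_mono) auto
    then show "cmod (p n t) \<le> K * (B ^ n /\<^sub>R fact n)"
      by (simp add: p_def norm_mult norm_power)
  qed (intro summable_mult summable_exp_generic)
  moreover have "(\<Sum>i. p i t) = T t * exp (h t)" for t
    unfolding p_def exp_def by (intro suminf_mult summable_exp_generic)
  ultimately have u: "uniform_limit {0..1} (\<lambda>n t. \<Sum>i<n. p i t) (\<lambda>t. T t * exp (h t)) sequentially"
    by simp
  have c: "continuous_on {0..1} (\<lambda>t. \<Sum>i<n. p i t)" for n
    by (rule trig_poly_continuous[OF trig_poly_sum[OF p]])
  obtain I J where I: "\<And>n. ((\<lambda>t. \<Sum>i<n. p i t) has_integral I n) {0..1}"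
    and J: "((\<lambda>t. T t * exp (h t)) has_integral J) {0..1}" and lim: "I \<longlonglongrightarrow> J"
    using uniform_limit_integral[OF u c] by auto
  have "I n = 0" for n
    using integral_unique[OF I[of n]]
      mean_trig_poly_eq_0[OF trig_poly_sum[of "{..<n}" "{..<0}" p, OF p]] by simp
  then have "I = (\<lambda>n. 0)" by auto
  with lim have "J = 0" by (simp add: LIMSEQ_const_iff)
  with J show ?thesis by (simp add: has_integral_iff)
qed

lemma fourier_coeff:
  assumes "finite A"
  shows "mean (\<lambda>t. character (- k) t * (\<Sum>l\<in>A. c l * character l t)) = (if k \<in> A then c k else 0)"
proof -
  have eq: "(\<lambda>t. character (- k) t * (\<Sum>l\<in>A. c l * character l t)) =
        (\<lambda>t. \<Sum>l\<in>A. c l * character (l - k) t)"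
    by (simp add: sum_distrib_left mult.left_commute character_mult)
  have "mean (\<lambda>t. \<Sum>l\<in>A. c l * character (l - k) t) = (\<Sum>l\<in>A. c l * mean (character (l - k)))"
    by (subst integral_sum) (auto simp: assms intro!: integrable_continuous_interval continuous_intros)
  also have "\<dots> = (\<Sum>l\<in>A. if l = k then c k else 0)"
    by (intro sum.cong) (auto simp: mean_character)
  also have "\<dots> = (if k \<in> A then c k else 0)" using assms by simp
  finally show ?thesis unfolding eq .
qed

lemma parseval:
  assumes "finite A"
  shows "mean (\<lambda>t. (cmod (\<Sum>k\<in>A. c k * character k t))\<^sup>2) = (\<Sum>k\<in>A. (cmod (c k))\<^sup>2)"
proof -
  define f where "f = (\<lambda>t. \<Sum>k\<in>A. c k * character k t)"
  have cf: "continuous_on {0..1} f" unfolding f_def by (intro continuous_intros)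
  have "complex_of_real ((cmod (f t))\<^sup>2) = (\<Sum>k\<in>A. cnj (c k) * (character (- k) t * f t))" for t
  proof -
    have "complex_of_real ((cmod (f t))\<^sup>2) = cnj (f t) * f t"
      by (metis complex_norm_square mult.commute)
    also have "\<dots> = (\<Sum>k\<in>A. cnj (c k) * (character (- k) t * f t))"
      by (subst (1) f_def) (simp add: cnj_character sum_distrib_right mult.assoc)
    finally show ?thesis .
  qed
  then have "mean (\<lambda>t. complex_of_real ((cmod (f t))\<^sup>2)) =
      mean (\<lambda>t. \<Sum>k\<in>A. cnj (c k) * (character (- k) t * f t))" by simp
  also have "\<dots> = (\<Sum>k\<in>A. cnj (c k) * mean (\<lambda>t. character (- k) t * f t))"
    by (subst integral_sum)
       (auto simp: assms intro!: cf integrable_continuous_interval continuous_intros)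
  also have "\<dots> = (\<Sum>k\<in>A. cnj (c k) * c k)"
    using fourier_coeff[OF assms, of _ c] by (simp add: f_def)
  also have "\<dots> = complex_of_real (\<Sum>k\<in>A. (cmod (c k))\<^sup>2)"
    unfolding of_real_sum by (metis complex_norm_square mult.commute)
  finally have "mean (\<lambda>t. complex_of_real ((cmod (f t))\<^sup>2)) = complex_of_real (\<Sum>k\<in>A. (cmod (c k))\<^sup>2)" .
  moreover have "((\<lambda>t. complex_of_real ((cmod (f t))\<^sup>2)) has_integral complex_of_real (mean (\<lambda>t. (cmod (f t))\<^sup>2))) {0..1}"
    by (intro has_integral_of_real integrable_integral integrable_continuous_interval continuous_intros cf)
  ultimately show ?thesis
    by (simp add: has_integral_iff f_def del: of_real_power of_real_sum)
qed

section \<open>Majorants with nonpositive frequencies\<close>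

text \<open>
  Since \<open>c * character m\<close> and its conjugate have the same real part, positive frequencies can be
  reflected to negative ones.  Also the constant term may be taken real.
\<close>

lemma Re_trig_poly_analytic:
  assumes "trig_poly UNIV T"
  shows "\<exists>(a::real) g. trig_poly {..<0} g \<and> (\<forall>t. Re (T t) = a + Re (g t))"
  using assms
proof (induction rule: trig_poly.induct)
  case (monom m c)
  consider "m < 0" | "m = 0" | "m > 0" by linarith
  then show ?case
  proof cases
    case 1
    then have "trig_poly {..<0} (\<lambda>t. c * character m t)" by (intro trig_poly.monom) auto
    then show ?thesis by (intro exI[of _ 0] exI[of _ "\<lambda>t. c * character m t"]) auto
  next
    case 2
    then show ?thesis by (intro exI[of _ "Re c"] exI[of _ "\<lambda>t. 0"]) (auto intro: trig_poly.zero)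
  next
    case 3
    have "Re (c * character m t) = Re (cnj c * character (- m) t)" for t
      by (simp flip: cnj_character)
    moreover have "trig_poly {..<0} (\<lambda>t. cnj c * character (- m) t)"
      using 3 by (intro trig_poly.monom) auto
    ultimately show ?thesis
      by (intro exI[of _ 0] exI[of _ "\<lambda>t. cnj c * character (- m) t"]) auto
  qed
next
  case zero
  then show ?case by (intro exI[of _ 0] exI[of _ "\<lambda>t. 0"]) (auto intro: trig_poly.zero)
next
  case (add f g)
  then obtain a b F G where "trig_poly {..<0} F" "\<forall>t. Re (f t) = a + Re (F t)"
     "trig_poly {..<0} G" "\<forall>t. Re (g t) = b + Re (G t)" by metis
  then show ?case
    by (intro exI[of _ "a + b"] exI[of _ "\<lambda>t. F t + G t"]) (auto intro: trig_poly.add)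
qed

text \<open>
  This is the boundedness of the conjugate function on \<open>L\<^sup>2\<close>.  With \<open>h = a + g\<close>, the square of \<open>h\<close> has
  constant term \<open>a\<^sup>2\<close>, so its mean is nonnegative; as the real part of \<open>h\<^sup>2\<close> is
  \<open>(Re h)\<^sup>2 - (Im h)\<^sup>2\<close>, the mean square of \<open>Im h\<close> is at most that of \<open>Re h\<close>.
\<close>

lemma mean_square_analytic:
  fixes a :: real and g :: "real \<Rightarrow> complex"
  assumes g: "trig_poly {..<0} g"
  shows "mean (\<lambda>t. (cmod (complex_of_real a + g t))\<^sup>2) \<le> 2 * mean (\<lambda>t. (a + Re (g t))\<^sup>2)"
proof -
  have cont: "continuous_on {0..1} g" by (rule trig_poly_continuous[OF g])
  have "trig_poly {..<0} (\<lambda>t. (2 * a) * g t + g t * g t)"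
    by (intro trig_poly.add trig_poly_cmult g trig_poly_mult[OF g g]) auto
  from mean_trig_poly_eq_0[OF this]
  have 0: "mean (\<lambda>t. (2 * a) * g t + g t * g t) = 0" by simp
  have 1: "((\<lambda>t. (2 * a) * g t + g t * g t) has_integral 0) {0..1}"
    using cont by (subst 0[symmetric], intro integrable_integral integrable_continuous_interval)
       (intro continuous_intros)
  have 2: "((\<lambda>t. (2 * (a + Re (g t))\<^sup>2 - (a\<^sup>2 + Re ((2 * a) * g t + g t * g t))))
      has_integral (2 * mean (\<lambda>t. (a + Re (g t))\<^sup>2) - (a\<^sup>2 + 0))) {0..1}"
  proof (intro has_integral_diff has_integral_add has_integral_mult_right integrable_integral
      integrable_continuous_interval)
    show "continuous_on {0..1} (\<lambda>t. (a + Re (g t))\<^sup>2)" using cont by (intro continuous_intros)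
    show "((\<lambda>t::real. a\<^sup>2) has_integral a\<^sup>2) {0..1}" using has_integral_const_real[of "a\<^sup>2" 0 1] by simp
    show "((\<lambda>t. Re ((2 * a) * g t + g t * g t)) has_integral 0) {0..1}"
      using has_integral_Re[OF 1] by simp
  qed
  have "(\<lambda>t. (2 * (a + Re (g t))\<^sup>2 - (a\<^sup>2 + Re ((2 * a) * g t + g t * g t)))) = (\<lambda>t. (cmod (a + g t))\<^sup>2)"
    unfolding cmod_power2 by (auto simp: power2_eq_square algebra_simps)
  with 2 have "mean (\<lambda>t. (cmod (a + g t))\<^sup>2) = 2 * mean (\<lambda>t. (a + Re (g t))\<^sup>2) - a\<^sup>2"
    by (simp add: has_integral_iff)
  then show ?thesis by simp
qed

text \<open>
  The modulus is the square root of the trigonometric polynomial \<open>f * cnj f\<close>, and Bernstein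
  polynomials approximate the square root uniformly on the unit interval.
\<close>

lemma trig_poly_norm_approx:
  assumes f: "trig_poly UNIV f" and f1: "\<And>t. cmod (f t) \<le> 1" and d: "\<delta> > 0"
  shows "\<exists>T. trig_poly UNIV T \<and> (\<forall>t. \<bar>cmod (f t) - Re (T t)\<bar> < \<delta>)"
proof -
  have "continuous_on {0..1} (sqrt :: real \<Rightarrow> real)" by (intro continuous_intros)
  from Bernstein_Weierstrass[OF this d] obtain n where n:
    "\<And>x. x \<in> {0..1} \<Longrightarrow> \<bar>sqrt x - (\<Sum>k\<le>n. sqrt (k/n) * Bernstein n k x)\<bar> < \<delta>" by auto
  define s where "s = (\<lambda>t. f t * cnj (f t))"
  define T where "T = (\<lambda>t. \<Sum>k\<le>n. (sqrt (k/n) * (n choose k)) * (s t ^ k * (1 + (-1) * s t) ^ (n - k)))"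
  have s: "trig_poly UNIV s" unfolding s_def
    by (rule trig_poly_mult[OF f trig_poly_cnj[OF f]]) auto
  have T: "trig_poly UNIV T"
    unfolding T_def
    by (intro trig_poly_sum trig_poly_cmult trig_poly_mult[where S=UNIV and T=UNIV] trig_poly_power
         trig_poly.add trig_poly_const s) auto
  have "s t = complex_of_real ((cmod (f t))\<^sup>2)" for t
    unfolding s_def by (metis complex_norm_square)
  then have "T t = complex_of_real (\<Sum>k\<le>n. sqrt (k/n) * Bernstein n k ((cmod (f t))\<^sup>2))" for t
    by (simp add: T_def Bernstein_def mult_ac)
  then have "\<bar>cmod (f t) - Re (T t)\<bar> < \<delta>" for t
    using n[of "(cmod (f t))\<^sup>2"] f1[of t] by (simp add: power_le_one)
  with T show ?thesis by auto
qed

text \<open>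
  The damping factors are exponentials of such \<open>h\<close>.  The modulus of \<open>f\<close> itself would serve as real
  part, with \<open>\<eta> = 0\<close>, but then \<open>h\<close> would in general be an infinite series; an
  approximation of it from above by a trigonometric polynomial costs an arbitrarily small \<open>\<eta>\<close>.
\<close>

lemma analytic_majorant:
  assumes f: "trig_poly UNIV f" and f1: "\<And>t. cmod (f t) \<le> 1" and eta: "\<eta> > 0"
  shows "\<exists>h. trig_poly {..0} h \<and> (\<forall>t. cmod (f t) \<le> Re (h t)) \<and>
           mean (\<lambda>t. (cmod (h t))\<^sup>2) \<le> 2 * mean (\<lambda>t. (cmod (f t))\<^sup>2) + \<eta>"
proof -
  define \<delta> where "\<delta> = min 1 (\<eta> / 16)"
  have d: "\<delta> > 0" "\<delta> \<le> 1" "16 * \<delta> \<le> \<eta>" using eta by (auto simp: \<delta>_def min_def)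
  obtain T where T: "trig_poly UNIV T" "\<And>t. \<bar>cmod (f t) - Re (T t)\<bar> < \<delta>"
    using trig_poly_norm_approx[OF f f1 d(1)] by auto
  obtain a g where g: "trig_poly {..<0} g" and ag: "\<And>t. Re (T t) = a + Re (g t)"
    using Re_trig_poly_analytic[OF T(1)] by auto
  define h where "h = (\<lambda>t. complex_of_real (a + \<delta>) + g t)"
  have "trig_poly {..0} h" unfolding h_def
    by (intro trig_poly.add trig_poly_const trig_poly_mono[OF g]) auto
  moreover have lo: "cmod (f t) \<le> Re (h t)" and hi: "Re (h t) \<le> cmod (f t) + 2 * \<delta>" for t
    using T(2)[of t] ag[of t] by (auto simp: h_def)
  moreover have "mean (\<lambda>t. (cmod (h t))\<^sup>2) \<le> 2 * mean (\<lambda>t. (cmod (f t))\<^sup>2) + \<eta>"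
  proof -
    have cf: "continuous_on {0..1} f" by (rule trig_poly_continuous[OF f])
    have cg: "continuous_on {0..1} g" by (rule trig_poly_continuous[OF g])
    have "mean (\<lambda>t. (Re (h t))\<^sup>2) \<le> mean (\<lambda>t. (cmod (f t))\<^sup>2 + 8 * \<delta>)"
    proof (intro integral_le integrable_continuous_interval)
      fix t
      have "(Re (h t))\<^sup>2 \<le> (cmod (f t) + 2 * \<delta>)\<^sup>2"
        using lo[of t] hi[of t] norm_ge_zero[of "f t"] by (intro power_mono) linarith+
      also have "\<dots> = (cmod (f t))\<^sup>2 + 4 * (cmod (f t) * \<delta>) + 4 * (\<delta> * \<delta>)"
        by (simp add: power2_eq_square algebra_simps)
      also have "\<dots> \<le> (cmod (f t))\<^sup>2 + 4 * (1 * \<delta>) + 4 * (1 * \<delta>)"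
        using d f1[of t] by (intro add_mono mult_left_mono mult_right_mono) auto
      finally show "(Re (h t))\<^sup>2 \<le> (cmod (f t))\<^sup>2 + 8 * \<delta>" by simp
    qed (use cf cg in \<open>auto simp: h_def intro!: continuous_intros\<close>)
    also have "\<dots> = mean (\<lambda>t. (cmod (f t))\<^sup>2) + 8 * \<delta>"
      using cf by (subst integral_add) (auto intro!: integrable_continuous_interval continuous_intros)
    finally show ?thesis
      using mean_square_analytic[OF g, of "a + \<delta>"] d by (simp add: h_def)
  qed
  ultimately show ?thesis by blast
qed

section \<open>The dual function of McGehee, Pigno and Smith\<close>

lemma norm_exp_minus_one_le:
  assumes "Re z \<le> 0"
  shows "cmod (exp z - 1) \<le> cmod z"
proof -
  have "cmod (exp z - exp 0) \<le> 1 * cmod (z - 0)"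
  proof (rule field_differentiable_bound)
    show "convex {w. Re w \<le> 0}" by (rule convex_halfspace_Re_le)
    show "(exp has_field_derivative exp w) (at w within {w. Re w \<le> 0})" for w :: complex
      by (auto intro!: derivative_eq_intros)
  qed (use assms in auto)
  then show ?thesis by simp
qed

text \<open>
  One step of the construction: damping by \<open>exp (- y / 4)\<close> makes room for a summand of modulus \<open>x\<close>
  under the ceiling \<open>5\<close>.  By \<open>exp (- s) \<le> 1 / (1 + s)\<close> it comes down to \<open>x\<^sup>2 \<le> x\<close>.
\<close>

lemma exp_damping_bound:
  fixes x y :: real
  assumes "0 \<le> x" "x \<le> 1" "x \<le> y"
  shows "5 * exp (- (y / 4)) + x \<le> 5"
proof -
  have "1 + x / 4 \<le> exp (y / 4)" using assms exp_ge_add_one_self[of "y/4"] by linarith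
  then have "exp (- (y / 4)) \<le> 1 / (1 + x / 4)"
    using assms by (simp add: exp_minus inverse_eq_divide frac_le)
  moreover have "5 * (1 / (1 + x / 4)) \<le> 5 - x"
  proof -
    have "x * x \<le> x * 1" using assms by (intro mult_left_mono)
    then have "5 \<le> (5 - x) * (1 + x / 4)" by (simp add: algebra_simps)
    then show ?thesis using assms by (simp add: divide_le_eq)
  qed
  ultimately show ?thesis by linarith
qed

lemma sum_halves: "(\<Sum>l\<in>{i<..m}. 1 / 2 ^ l) \<le> (1::real) / 2 ^ i"
proof (cases "i \<le> m")
  case True
  then have "(\<Sum>l\<in>{i<..m}. 1 / 2 ^ l) = (1::real) / 2 ^ i - 1 / 2 ^ m"
  proof (induction m rule: dec_induct)
    case (step n)
    have "{i<..Suc n} = insert (Suc n) {i<..n}" using step(1) by auto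
    then show ?case using step(3) by simp
  qed simp
  then show ?thesis by simp
qed auto

lemma sum_quarters: "(\<Sum>i\<in>{j..m}. 1 / 4 ^ i) \<le> (4::real) / 3 / 4 ^ j"
proof (cases "j \<le> m")
  case True
  then have "(\<Sum>i\<in>{j..m}. 1 / 4 ^ i) = (4::real) / 3 / 4 ^ j - 1 / 3 / 4 ^ m"
  proof (induction m rule: dec_induct)
    case (step n)
    have "{j..Suc n} = insert (Suc n) {j..n}" using step(1) by auto
    then show ?case using step(3) by simp
  qed simp
  then show ?thesis by simp
qed auto

text \<open>
  The Cauchy-Schwarz inequality, by weighting the inequality of arithmetic and geometric means.
\<close>

lemma mean_norm_mult_le:
  fixes f g :: "real \<Rightarrow> complex"
  assumes f: "continuous_on {0..1} f" and g: "continuous_on {0..1} g"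
    and f2: "mean (\<lambda>t. (cmod (f t))\<^sup>2) \<le> a\<^sup>2" and g2: "mean (\<lambda>t. (cmod (g t))\<^sup>2) \<le> b\<^sup>2"
    and ab: "a > 0" "b > 0"
  shows "mean (\<lambda>t. cmod (f t) * cmod (g t)) \<le> a * b"
proof -
  have "mean (\<lambda>t. cmod (f t) * cmod (g t)) \<le>
      mean (\<lambda>t. b / (2 * a) * (cmod (f t))\<^sup>2 + a / (2 * b) * (cmod (g t))\<^sup>2)"
  proof (intro integral_le integrable_continuous_interval)
    fix t
    have "0 \<le> (b * cmod (f t) - a * cmod (g t))\<^sup>2" by simp
    then have "2 * (a * b) * (cmod (f t) * cmod (g t)) \<le> b\<^sup>2 * (cmod (f t))\<^sup>2 + a\<^sup>2 * (cmod (g t))\<^sup>2"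
      by (simp add: power2_eq_square algebra_simps)
    with ab show "cmod (f t) * cmod (g t) \<le> b / (2 * a) * (cmod (f t))\<^sup>2 + a / (2 * b) * (cmod (g t))\<^sup>2"
      by (simp add: field_simps power2_eq_square)
  qed (use f g ab in \<open>auto intro!: continuous_intros\<close>)
  also have "\<dots> = b / (2 * a) * mean (\<lambda>t. (cmod (f t))\<^sup>2) + a / (2 * b) * mean (\<lambda>t. (cmod (g t))\<^sup>2)"
    by (subst integral_add) (use f g ab in \<open>auto intro!: continuous_intros integrable_continuous_interval\<close>)
  also have "\<dots> \<le> b / (2 * a) * a\<^sup>2 + a / (2 * b) * b\<^sup>2"
    using f2 g2 ab by (intro add_mono mult_left_mono) auto
  also have "\<dots> = a * b" using ab by (simp add: field_simps power2_eq_square)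
  finally show ?thesis .
qed

text \<open>
  With \<open>f i = (\<Sum>k\<in>S i. u k / 4 ^ i * character k)\<close>, of modulus at most \<open>1\<close> and mean square \<open>1 / 4 ^ i\<close>,
  and majorants \<open>h i\<close> of \<open>f i\<close>, the function is
  \<open>F m = (\<Sum>i\<le>m. f i * exp (- (\<Sum>l\<in>{i<..m}. h l) / 4))\<close>.  It stays bounded because
  \<open>F (m + 1) = F m * exp (- h (m + 1) / 4) + f (m + 1)\<close>.  For a frequency \<open>k\<close> in block \<open>j\<close>, the summands
  with \<open>i < j\<close> do not contribute, as damping only moves their frequencies down, away from \<open>k\<close>.
  The summand \<open>i = j\<close> contributes \<open>u k / 4 ^ j\<close>, up to an error.  The error of every summand
  \<open>i \<ge> j\<close> is at most the mean of the modulus of \<open>f i\<close> times that of \<open>exp (\<dots>) - 1\<close>; since blocks grow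
  by the factor \<open>4\<close>, the mean squares shrink geometrically and these errors sum to at most half of
  the main term.
\<close>

lemma dual_function:
  fixes S :: "nat \<Rightarrow> int set" and u :: "int \<Rightarrow> complex" and m :: nat
  assumes blocks: "\<forall>i\<le>m. card (S i) = 4 ^ i" "\<forall>j\<le>m. \<forall>i<j. \<forall>x\<in>S i. \<forall>y\<in>S j. x < y"
    and unimodular: "\<forall>k. cmod (u k) = 1"
  shows "\<exists>F. continuous_on {0..1} F \<and> (\<forall>t. cmod (F t) \<le> 5) \<and>
    (\<forall>j\<le>m. \<forall>k\<in>S j. 1 / (2 * 4 ^ j) \<le> Re (cnj (u k) * mean (\<lambda>t. character (- k) t * F t))) \<and>
    (\<forall>k. (\<forall>j\<le>m. \<forall>x\<in>S j. x < k) \<longrightarrow> mean (\<lambda>t. character (- k) t * F t) = 0)"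
proof -
  have card: "\<And>i. i \<le> m \<Longrightarrow> card (S i) = 4 ^ i"
    and less: "\<And>i j x y. i < j \<Longrightarrow> j \<le> m \<Longrightarrow> x \<in> S i \<Longrightarrow> y \<in> S j \<Longrightarrow> x < y"
    using blocks by blast+
  have u: "\<And>k. cmod (u k) = 1" using unimodular by blast
  have fin: "finite (S i)" if "i \<le> m" for i
    using card[OF that] by (intro card_ge_0_finite) simp
  define f where "f = (\<lambda>i t. \<Sum>k\<in>S i. u k / 4 ^ i * character k t)"
  have f_trig: "trig_poly (S i) (f i)" for i
    unfolding f_def by (intro trig_poly_sum trig_poly.monom)
  have f_cont: "continuous_on {0..1} (f i)" for i
    by (rule trig_poly_continuous[OF f_trig])
  have f_bound: "cmod (f i t) \<le> 1" if "i \<le> m" for i t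
  proof -
    have "cmod (f i t) \<le> (\<Sum>k\<in>S i. 1 / 4 ^ i)"
      unfolding f_def by (intro sum_norm_le) (simp add: norm_mult norm_divide norm_power u)
    then show ?thesis using card[OF that] by simp
  qed
  have f_mean: "mean (\<lambda>t. (cmod (f i t))\<^sup>2) = (1 / 2 ^ i)\<^sup>2" if "i \<le> m" for i
  proof -
    have "mean (\<lambda>t. (cmod (f i t))\<^sup>2) = 4 ^ i * (1 / (4 ^ i * 4 ^ i))"
      using card[OF that] unfolding f_def
      by (subst parseval[OF fin[OF that]]) (simp add: norm_divide norm_power u power2_eq_square)
    also have "\<dots> = 1 / 4 ^ i" by simp
    also have "\<dots> = (1 / 2 ^ i)\<^sup>2"
      by (simp add: power_divide power2_eq_square flip: power_mult_distrib)
    finally show ?thesis .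
  qed
  have "\<exists>h. trig_poly {..0} h \<and> (\<forall>t. cmod (f i t) \<le> Re (h t)) \<and>
          mean (\<lambda>t. (cmod (h t))\<^sup>2) \<le> (3 / 2 / 2 ^ i)\<^sup>2" if i: "i \<le> m" for i
  proof -
    have "trig_poly UNIV (f i)" by (rule trig_poly_mono[OF f_trig]) auto
    \<comment> \<open>The slack is chosen to make the mean square at most \<open>(2 + 1 / 4) / 4 ^ i\<close>, a perfect square.\<close>
    from analytic_majorant[OF this f_bound[OF i], of "1 / 4 * (1 / 2 ^ i)\<^sup>2"]
    show ?thesis by (simp add: f_mean[OF i] power_divide field_simps)
  qed
  then obtain h where h: "\<And>i. i \<le> m \<Longrightarrow> trig_poly {..0} (h i)"
    and fh: "\<And>i t. i \<le> m \<Longrightarrow> cmod (f i t) \<le> Re (h i t)"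
    and h_mean: "\<And>i. i \<le> m \<Longrightarrow> mean (\<lambda>t. (cmod (h i t))\<^sup>2) \<le> (3 / 2 / 2 ^ i)\<^sup>2"
    by metis
  have h_cont: "continuous_on {0..1} (h i)" if "i \<le> m" for i
    by (rule trig_poly_continuous[OF h[OF that]])
  have h_Re: "0 \<le> Re (h i t)" if "i \<le> m" for i t
    using fh[OF that, of t] norm_ge_zero[of "f i t"] by linarith
  define H where "H = (\<lambda>n i t. (- 1 / 4) * (\<Sum>l\<in>{i<..n}. h l t))"
  define F where "F = (\<lambda>n t. \<Sum>i\<le>n. f i t * exp (H n i t))"
  have H_trig: "trig_poly {..0} (H m i)" for i
    unfolding H_def by (intro trig_poly_cmult trig_poly_sum h) auto
  have H_cont: "continuous_on {0..1} (H m i)" for i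
    by (rule trig_poly_continuous[OF H_trig])
  have F_cont: "continuous_on {0..1} (F m)"
    unfolding F_def by (intro continuous_intros f_cont H_cont)
  have F_bound: "cmod (F n t) \<le> 5" if "n \<le> m" for n t
    using that
  proof (induction n)
    case 0
    then show ?case using f_bound[of 0 t] by (simp add: F_def H_def)
  next
    case (Suc n)
    have "exp (H (Suc n) i t) = exp (H n i t) * exp ((- 1 / 4) * h (Suc n) t)" if "i \<le> n" for i
    proof -
      have "{i<..Suc n} = insert (Suc n) {i<..n}" using that by auto
      then have "H (Suc n) i t = H n i t + (- 1 / 4) * h (Suc n) t"
        by (simp add: H_def algebra_simps)
      then show ?thesis by (simp only: exp_add)
    qed
    moreover have "H (Suc n) (Suc n) t = 0" by (simp add: H_def)
    ultimately have "F (Suc n) t = F n t * exp ((- 1 / 4) * h (Suc n) t) + f (Suc n) t"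
      by (simp add: F_def sum_distrib_right mult.assoc)
    then have "cmod (F (Suc n) t) \<le> cmod (F n t) * exp (- (Re (h (Suc n) t) / 4)) + cmod (f (Suc n) t)"
      by (auto simp: norm_mult intro!: order_trans[OF norm_triangle_ineq])
    also have "\<dots> \<le> 5 * exp (- (Re (h (Suc n) t) / 4)) + cmod (f (Suc n) t)"
      using Suc by (intro add_right_mono mult_right_mono) auto
    also have "\<dots> \<le> 5"
      using Suc.prems by (intro exp_damping_bound f_bound fh) auto
    finally show ?case .
  qed
  have coeff: "mean (\<lambda>t. character (- k) t * F m t) =
      (\<Sum>i\<le>m. mean (\<lambda>t. character (- k) t * f i t * exp (H m i t)))" for k
  proof -
    have "mean (\<lambda>t. character (- k) t * F m t) =
        mean (\<lambda>t. \<Sum>i\<le>m. character (- k) t * f i t * exp (H m i t))"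
      by (simp add: F_def sum_distrib_left mult_ac)
    also have "\<dots> = (\<Sum>i\<le>m. mean (\<lambda>t. character (- k) t * f i t * exp (H m i t)))"
      by (rule integral_sum) (auto intro!: integrable_continuous_interval continuous_intros f_cont H_cont)
    finally show ?thesis .
  qed
  have lower: "mean (\<lambda>t. character (- k) t * f i t * exp (H m i t)) = 0"
    if "\<And>x. x \<in> S i \<Longrightarrow> x < k" for i k
  proof (rule mean_trig_poly_mult_exp[OF _ H_trig])
    have "trig_poly {- k} (character (- k))" using trig_poly.monom[of "- k" "{- k}" 1] by simp
    then show "trig_poly {..<0} (\<lambda>t. character (- k) t * f i t)"
      by (rule trig_poly_mult[OF _ f_trig]) (use that in auto)
  qed
  have upper: "cmod (mean (\<lambda>t. character (- k) t * f i t * exp (H m i t)) - (if k \<in> S i then u k / 4 ^ i else 0))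
       \<le> 3 / 8 / 4 ^ i" if i: "i \<le> m" for i k
  proof -
    have "mean (\<lambda>t. character (- k) t * f i t) = (if k \<in> S i then u k / 4 ^ i else 0)"
      using fourier_coeff[OF fin[OF i], of k "\<lambda>k. u k / 4 ^ i"] by (simp add: f_def)
    then have "mean (\<lambda>t. character (- k) t * f i t * exp (H m i t)) - (if k \<in> S i then u k / 4 ^ i else 0)
       = mean (\<lambda>t. character (- k) t * f i t * exp (H m i t) - character (- k) t * f i t)"
      by (subst integral_diff) (auto intro!: integrable_continuous_interval continuous_intros f_cont H_cont)
    also have "cmod \<dots> \<le> mean (\<lambda>t. 1 / 4 * (\<Sum>l\<in>{i<..m}. cmod (f i t) * cmod (h l t)))"
    proof (rule integral_norm_bound_integral)
      fix t :: real
      have "character (- k) t * f i t * exp (H m i t) - character (- k) t * f i t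
          = character (- k) t * f i t * (exp (H m i t) - 1)" by (simp add: algebra_simps)
      also have "cmod \<dots> = cmod (f i t) * cmod (exp (H m i t) - 1)" by (simp add: norm_mult)
      also have "\<dots> \<le> cmod (f i t) * cmod (H m i t)"
      proof (intro mult_left_mono norm_exp_minus_one_le)
        have "0 \<le> (\<Sum>l\<in>{i<..m}. Re (h l t))" by (intro sum_nonneg h_Re) auto
        then show "Re (H m i t) \<le> 0" by (simp add: H_def)
      qed auto
      also have "\<dots> \<le> cmod (f i t) * (1 / 4 * (\<Sum>l\<in>{i<..m}. cmod (h l t)))"
        unfolding H_def by (intro mult_left_mono) (auto simp: norm_mult norm_divide intro!: norm_sum)
      also have "\<dots> = 1 / 4 * (\<Sum>l\<in>{i<..m}. cmod (f i t) * cmod (h l t))"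
        by (simp add: sum_distrib_left)
      finally show "cmod (character (- k) t * f i t * exp (H m i t) - character (- k) t * f i t)
        \<le> 1 / 4 * (\<Sum>l\<in>{i<..m}. cmod (f i t) * cmod (h l t))" .
    qed (auto intro!: integrable_continuous_interval continuous_intros f_cont H_cont h_cont)
    also have "\<dots> = 1 / 4 * (\<Sum>l\<in>{i<..m}. mean (\<lambda>t. cmod (f i t) * cmod (h l t)))"
      by (simp, subst integral_sum)
         (auto intro!: integrable_continuous_interval continuous_intros f_cont h_cont)
    also have "\<dots> \<le> 1 / 4 * (\<Sum>l\<in>{i<..m}. 1 / 2 ^ i * (3 / 2 / 2 ^ l))"
      using i by (intro mult_left_mono sum_mono mean_norm_mult_le f_cont h_cont h_mean) (auto simp: f_mean)
    also have "\<dots> = 3 / 8 / 2 ^ i * (\<Sum>l\<in>{i<..m}. 1 / 2 ^ l)"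
      by (simp add: sum_distrib_left mult.assoc)
    also have "\<dots> \<le> 3 / 8 / 2 ^ i * (1 / 2 ^ i)"
      by (intro mult_left_mono sum_halves) auto
    also have "\<dots> = 3 / 8 / 4 ^ i" by (simp flip: power_mult_distrib)
    finally show ?thesis .
  qed
  show ?thesis
  proof (intro exI[of _ "F m"] conjI allI impI ballI F_cont F_bound order_refl)
    fix k assume "\<forall>j\<le>m. \<forall>x\<in>S j. x < k"
    then show "mean (\<lambda>t. character (- k) t * F m t) = 0"
      unfolding coeff by (intro sum.neutral ballI lower) auto
  next
    fix j k assume j: "j \<le> m" and k: "k \<in> S j"
    define M where "M = (\<lambda>i. mean (\<lambda>t. character (- k) t * f i t * exp (H m i t)))"
    define D where "D = (\<lambda>i. if k \<in> S i then u k / 4 ^ i else 0)"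
    have D: "D i = (if i = j then u k / 4 ^ j else 0)" if "i \<le> m" for i
      using less[of i j k k] less[of j i k k] j k that unfolding D_def
      by (metis less_irrefl nat_neq_iff)
    have "mean (\<lambda>t. character (- k) t * F m t) = (\<Sum>i\<in>{j..m}. M i)"
      unfolding coeff M_def using less[of _ j _ k] j k
      by (intro sum.mono_neutral_right ballI lower) (auto simp: not_le)
    also have "\<dots> = (\<Sum>i\<in>{j..m}. D i) + (\<Sum>i\<in>{j..m}. M i - D i)"
      by (simp add: sum_subtractf)
    also have "(\<Sum>i\<in>{j..m}. D i) = (\<Sum>i\<in>{j..m}. if i = j then u k / 4 ^ j else 0)"
      by (intro sum.cong D) auto
    also have "\<dots> = u k / 4 ^ j" using j by simp
    finally have eq: "cnj (u k) * mean (\<lambda>t. character (- k) t * F m t) =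
        of_real (1 / 4 ^ j) + cnj (u k) * (\<Sum>i\<in>{j..m}. M i - D i)"
      using complex_norm_square[of "u k"] u[of k] by (simp add: distrib_left mult.commute)
    have "cmod (cnj (u k) * (\<Sum>i\<in>{j..m}. M i - D i)) \<le> (\<Sum>i\<in>{j..m}. 3 / 8 / 4 ^ i)"
      using upper[of _ k] by (auto simp: norm_mult u M_def D_def intro!: sum_norm_le)
    also have "\<dots> = 3 / 8 * (\<Sum>i\<in>{j..m}. 1 / 4 ^ i)" by (simp add: sum_distrib_left)
    also have "\<dots> \<le> 3 / 8 * (4 / 3 / 4 ^ j)" by (intro mult_left_mono sum_quarters) auto
    finally have "cmod (cnj (u k) * (\<Sum>i\<in>{j..m}. M i - D i)) \<le> 1 / (2 * 4 ^ j)" by simp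
    with abs_Re_le_cmod[of "cnj (u k) * (\<Sum>i\<in>{j..m}. M i - D i)"]
    have "Re (cnj (u k) * (\<Sum>i\<in>{j..m}. M i - D i)) \<ge> - (1 / (2 * 4 ^ j))" by linarith
    then show "1 / (2 * 4 ^ j) \<le> Re (cnj (u k) * mean (\<lambda>t. character (- k) t * F m t))"
      unfolding eq by (simp add: field_simps)
  qed
qed

section \<open>Real trigonometric polynomials take very negative values\<close>

text \<open>
  Cut the increasing enumeration of \<open>A\<close> into consecutive pieces, starting from the bottom.  What
  remains lies above all pieces, where the dual function has no frequencies.
\<close>

lemma increasing_blocks:
  fixes A :: "'a::linorder set" and a :: "nat \<Rightarrow> nat"
  assumes fin: "finite A" and le: "(\<Sum>i\<le>m. a i) \<le> card A"
  obtains S where "\<forall>i\<le>m. card (S i) = a i" "\<forall>i\<le>m. S i \<subseteq> A"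
    "\<forall>j\<le>m. \<forall>i<j. \<forall>x\<in>S i. \<forall>y\<in>S j. x < y"
    "\<forall>i\<le>m. \<forall>x\<in>S i. \<forall>k\<in>A - (\<Union>j\<le>m. S j). x < k"
proof -
  define xs where "xs = sorted_list_of_set A"
  define s where "s = (\<lambda>i. \<Sum>l<i. a l)"
  define S where "S = (\<lambda>i. (!) xs ` {s i..<s (Suc i)})"
  have len: "length xs = card A" and dist: "distinct xs" and set: "set xs = A"
    using fin by (auto simp: xs_def)
  have s_mono: "s i \<le> s j" if "i \<le> j" for i j
    unfolding s_def using that by (intro sum_mono2) auto
  have s_le: "s (Suc i) \<le> card A" if "i \<le> m" for i
    using s_mono[of "Suc i" "Suc m"] le that by (simp add: s_def lessThan_Suc_atMost)
  have nth_less: "xs ! p < xs ! q" if "p < q" "q < card A" for p q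
    using sorted_wrt_nth_less[OF strict_sorted_list_of_set[of A], of p q] that len
    by (simp add: xs_def)
  have S1: "card (S i) = a i" if "i \<le> m" for i
  proof -
    have "inj_on ((!) xs) {s i..<s (Suc i)}"
      using dist s_le[OF that] len by (auto simp: inj_on_def nth_eq_iff_index_eq)
    then show ?thesis by (simp add: S_def card_image) (simp add: s_def)
  qed
  have S2: "S i \<subseteq> A" if "i \<le> m" for i
    using s_le[OF that] len set by (auto simp: S_def intro!: nth_mem)
  have S3: "x < y" if "i < j" "j \<le> m" "x \<in> S i" "y \<in> S j" for i j x y
    using that s_mono[of "Suc i" j] s_le[of j] by (auto simp: S_def intro!: nth_less)
  have S4: "x < k" if i: "i \<le> m" and x: "x \<in> S i" and k: "k \<in> A - (\<Union>j\<le>m. S j)" for i x k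
  proof -
    obtain q where q: "q < card A" "k = xs ! q"
      using k set len by (auto simp: in_set_conv_nth)
    have "\<not> q < s (Suc m)"
    proof
      assume "q < s (Suc m)"
      then obtain j where "j < Suc m" "s j \<le> q" "q < s j + a j"
        using less_sum_nat_iff[of q a "Suc m"] by (auto simp: s_def)
      then have "j \<le> m" "k \<in> S j" using q by (auto simp: S_def s_def)
      with k show False by auto
    qed
    then show ?thesis
      using x s_mono[of "Suc i" "Suc m"] i q by (auto simp: S_def intro!: nth_less)
  qed
  show thesis
  proof (rule that[of S])
    show "\<forall>i\<le>m. card (S i) = a i" "\<forall>i\<le>m. S i \<subseteq> A" using S1 S2 by simp_all
    show "\<forall>j\<le>m. \<forall>i<j. \<forall>x\<in>S i. \<forall>y\<in>S j. x < y"
      by (intro allI impI ballI) (rule S3)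
    show "\<forall>i\<le>m. \<forall>x\<in>S i. \<forall>k\<in>A - (\<Union>j\<le>m. S j). x < k"
      by (intro allI impI ballI) (rule S4)
  qed
qed

text \<open>
  Both sides come from the mean of \<open>p * F\<close>, with \<open>F\<close> the dual function for the directions of the
  coefficients.  Since \<open>p\<close> is real, it may be replaced by its conjugate, and the mean becomes the sum
  of the products \<open>cnj (c k) * mean (character (- k) * F)\<close>: each of the \<open>m + 1\<close> blocks contributes
  at least \<open>\<beta> / 2\<close>, and the frequencies above all blocks contribute nothing.  On the other hand
  \<open>p * F = (p + M) * F - M * F\<close>, where \<open>p + M \<ge> 0\<close> has mean \<open>M\<close> and \<open>F\<close> is bounded by \<open>5\<close>.
\<close>

lemma trig_poly_min_bound:
  fixes A :: "int set" and c :: "int \<Rightarrow> complex" and M \<beta> :: real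
  defines "p \<equiv> (\<lambda>t. \<Sum>k\<in>A. c k * character k t)"
  assumes fin: "finite A" and "0 \<notin> A" and \<beta>: "\<beta> > 0" "\<And>k. k \<in> A \<Longrightarrow> \<beta> \<le> cmod (c k)"
    and card: "(\<Sum>i\<le>m. 4 ^ i) \<le> card A"
    and real: "\<And>t. Im (p t) = 0" and lower: "\<And>t. - M \<le> Re (p t)"
  shows "\<beta> * real (Suc m) \<le> 20 * M"
proof -
  obtain S where S_card: "\<forall>i\<le>m. card (S i) = 4 ^ i" and S_sub: "\<forall>i\<le>m. S i \<subseteq> A"
    and S_less: "\<forall>j\<le>m. \<forall>i<j. \<forall>x\<in>S i. \<forall>y\<in>S j. x < y"
    and S_top: "\<forall>i\<le>m. \<forall>x\<in>S i. \<forall>k\<in>A - (\<Union>j\<le>m. S j). x < k"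
    by (rule increasing_blocks[OF fin card])
  define u where "u = (\<lambda>k. cis (Arg (c k)))"
  have "\<forall>k. cmod (u k) = 1" by (simp add: u_def)
  from dual_function[OF S_card S_less this]
  obtain F where F: "continuous_on {0..1} F" "\<forall>t. cmod (F t) \<le> 5"
    and F_S: "\<forall>j\<le>m. \<forall>k\<in>S j.
      1 / (2 * 4 ^ j) \<le> Re (cnj (u k) * mean (\<lambda>t. character (- k) t * F t))"
    and F_0: "\<forall>k. (\<forall>j\<le>m. \<forall>x\<in>S j. x < k) \<longrightarrow> mean (\<lambda>t. character (- k) t * F t) = 0"
    by (elim exE conjE) (rule that)
  have p_trig: "trig_poly A p"
    unfolding p_def by (intro trig_poly_sum trig_poly.monom)
  have p_cont: "continuous_on {0..1} p" by (rule trig_poly_continuous[OF p_trig])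
  define r where "r = (\<lambda>t. Re (p t) + M)"
  have r: "p t + M = complex_of_real (r t)" for t
    using real[of t] by (simp add: r_def complex_eq_iff)
  have r_cont: "continuous_on {0..1} r"
    unfolding r_def by (intro continuous_intros p_cont)
  have "(p has_integral 0) {0..1}"
    using integrable_integral[OF integrable_continuous_interval[OF p_cont]]
      mean_trig_poly_eq_0[OF p_trig \<open>0 \<notin> A\<close>] by simp
  from has_integral_Re[OF this] have "(r has_integral 0 + M) {0..1}"
    unfolding r_def using has_integral_const_real[of M 0 1] by (intro has_integral_add) auto
  then have r_mean: "mean r = M" by (simp add: integral_unique)
  define q where "q = (\<lambda>k. Re (cnj (c k) * mean (\<lambda>t. character (- k) t * F t)))"
  have q_S: "\<beta> / (2 * 4 ^ j) \<le> q k" if "j \<le> m" "k \<in> S j" for j k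
  proof -
    have Re_scale: "Re (complex_of_real a * w) = a * Re w" for a w by simp
    have "cmod (c k) * u k = c k" using rcis_cmod_Arg[of "c k"] by (simp add: u_def rcis_def)
    then have "cnj (c k) = cnj (cmod (c k) * u k)" by simp
    also have "\<dots> = cmod (c k) * cnj (u k)"
      by (simp only: complex_cnj_mult complex_cnj_complex_of_real)
    finally have "q k = cmod (c k) * Re (cnj (u k) * mean (\<lambda>t. character (- k) t * F t))"
      by (simp only: q_def mult.assoc Re_scale)
    moreover have "\<beta> * (1 / (2 * 4 ^ j)) \<le> \<dots>"
    proof (rule mult_mono)
      show "\<beta> \<le> cmod (c k)" using \<beta>(2) S_sub that by blast
      show "1 / (2 * 4 ^ j) \<le> Re (cnj (u k) * mean (\<lambda>t. character (- k) t * F t))"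
        using F_S that by blast
    qed auto
    ultimately show ?thesis by simp
  qed
  have "\<beta> / 2 * real (Suc m) = (\<Sum>i\<le>m. \<Sum>k\<in>S i. \<beta> / (2 * 4 ^ i))"
    using S_card by simp
  also have "\<dots> \<le> (\<Sum>i\<le>m. \<Sum>k\<in>S i. q k)"
    by (intro sum_mono q_S) auto
  also have "\<dots> = sum q (\<Union>i\<le>m. S i)"
  proof (rule sum.UNION_disjoint[symmetric])
    show "\<forall>i\<in>{..m}. finite (S i)" using S_sub fin finite_subset by blast
    show "\<forall>i\<in>{..m}. \<forall>j\<in>{..m}. i \<noteq> j \<longrightarrow> S i \<inter> S j = {}"
    proof (intro ballI impI)
      fix i j assume "i \<in> {..m}" "j \<in> {..m}" "i \<noteq> j"
      then consider "i < j" "j \<le> m" | "j < i" "i \<le> m" by fastforce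
      then show "S i \<inter> S j = {}" using S_less by cases blast+
    qed
  qed auto
  also have "\<dots> = sum q A"
  proof (rule sum.mono_neutral_left)
    show "\<forall>k\<in>A - (\<Union>i\<le>m. S i). q k = 0"     proof
      fix k assume k: "k \<in> A - (\<Union>i\<le>m. S i)"
      then have "mean (\<lambda>t. character (- k) t * F t) = 0" using F_0 S_top by blast
      then show "q k = 0" by (simp add: q_def)
    qed
    show "(\<Union>i\<le>m. S i) \<subseteq> A" using S_sub by blast
  qed (rule fin)
  also have "sum q A = Re (mean (\<lambda>t. p t * F t))"
  proof -
    have "cnj (p t) = p t" for t using real[of t] by (simp add: complex_eq_iff)
    then have "p t * F t = cnj (p t) * F t" for t by simp
    then have "p t * F t = (\<Sum>k\<in>A. cnj (c k) * (character (- k) t * F t))" for t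
      by (simp add: p_def cnj_character sum_distrib_right mult.assoc)
    then have "mean (\<lambda>t. p t * F t) = mean (\<lambda>t. \<Sum>k\<in>A. cnj (c k) * (character (- k) t * F t))"
      by simp
    also have "\<dots> = (\<Sum>k\<in>A. cnj (c k) * mean (\<lambda>t. character (- k) t * F t))"
      by (subst integral_sum)
         (auto simp: fin intro!: F(1) integrable_continuous_interval continuous_intros)
    finally show ?thesis by (simp add: q_def)
  qed
  also have "mean (\<lambda>t. p t * F t) = mean (\<lambda>t. complex_of_real (r t) * F t - M * F t)"
    by (simp add: algebra_simps flip: r)
  also have "\<dots> = mean (\<lambda>t. complex_of_real (r t) * F t) - M * mean F"
    by (subst integral_diff)
       (auto intro!: F(1) r_cont integrable_continuous_interval continuous_intros)
  also have "Re \<dots> \<le> cmod \<dots>" by (rule complex_Re_le_cmod)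
  also have "\<dots> \<le> cmod (mean (\<lambda>t. complex_of_real (r t) * F t)) + cmod (M * mean F)"
    by (rule norm_triangle_ineq4)
  also have "\<dots> \<le> 5 * M + M * 5"
  proof (intro add_mono)
    have r0: "0 \<le> r t" for t using lower[of t] by (simp add: r_def)
    have "cmod (mean (\<lambda>t. complex_of_real (r t) * F t)) \<le> mean (\<lambda>t. 5 * r t)"
      using F(2) r0
      by (intro integral_norm_bound_integral integrable_continuous_interval continuous_intros F(1) r_cont)
         (auto simp: norm_mult mult.commute[of 5] intro!: mult_left_mono)
    then show "cmod (mean (\<lambda>t. complex_of_real (r t) * F t)) \<le> 5 * M"
      by (simp add: r_mean)
    have "0 \<le> M"
      using integral_nonneg[of r "{0..1}"] r0 r_mean r_cont by (auto intro: integrable_continuous_interval)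
    moreover have "cmod (mean F) \<le> mean (\<lambda>t::real. 5)"
      using F by (intro integral_norm_bound_integral integrable_continuous_interval continuous_intros) auto
    ultimately show "cmod (M * mean F) \<le> M * 5"
      by (simp add: norm_mult mult_left_mono)
  qed
  finally show ?thesis by simp
qed

text \<open>
  Take as many blocks of sizes \<open>1, 4, 16, \<dots>\<close> as fit into \<open>n\<close>; one more would not fit, so \<open>n\<close> is at
  most \<open>4 ^ (m + 2)\<close>, and \<open>(m + 2) * ln 4\<close> is at most \<open>14 / 5 * (m + 1)\<close>.
\<close>

lemma ln_le_block_count:
  assumes "n \<ge> 1"
  obtains m where "(\<Sum>i\<le>m. 4 ^ i) \<le> n" "ln (real n) \<le> 14 / 5 * real (Suc m)"
proof -
  define s where "s = (\<lambda>m. \<Sum>i\<le>m. 4 ^ i :: nat)"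
  have s_le: "s m \<le> 4 ^ Suc m" for m unfolding s_def by (induction m) auto
  have s_ge: "m < s m" for m unfolding s_def by (induction m) (auto simp: Suc_le_eq intro: le_less_trans)
  define m where "m = (LEAST m. n < s (Suc m))"
  have "n < s (Suc n)" using s_ge[of "Suc n"] by simp
  then have m: "n < s (Suc m)" unfolding m_def by (rule LeastI)
  have le: "s m \<le> n"
  proof (cases m)
    case 0
    then show ?thesis using assms by (simp add: s_def)
  next
    case (Suc l)
    then have "\<not> n < s (Suc l)" unfolding m_def by (intro not_less_Least) (simp add: m_def)
    with Suc show ?thesis by simp
  qed
  have "real n \<le> real (4 ^ Suc (Suc m))"
    using m s_le[of "Suc m"] by (intro of_nat_mono) linarith
  also have "\<dots> = 2 ^ (2 * Suc (Suc m))" by (simp add: power_mult)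
  finally have "ln (real n) \<le> ln (2 ^ (2 * Suc (Suc m)))"
    using assms by (subst ln_le_cancel_iff) auto
  also have "\<dots> = 2 * real (Suc (Suc m)) * ln 2" by (subst ln_realpow) auto
  also have "\<dots> \<le> 2 * real (Suc (Suc m)) * (25 / 36)"
    by (intro mult_left_mono ln2_le_25_over_36) auto
  also have "\<dots> \<le> 14 / 5 * real (Suc m)" by (simp add: field_simps)
  finally show ?thesis using le that by (simp add: s_def)
qed

section \<open>Characters as limits of simultaneous powers\<close>

text \<open>
  Choose a largest independent subset of \<open>insert 1 \<Theta>\<close> that contains \<open>1\<close>.  Any other element satisfies
  a nontrivial integer relation with it in which its own coefficient is nonzero.  It is
  essential that \<open>1\<close> belongs to the basis, because Kronecker's theorem works modulo \<open>1\<close>.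
\<close>

lemma finite_int_basis:
  fixes \<Theta> :: "real set"
  assumes fin: "finite \<Theta>"
  obtains B C D where "finite B" "1 \<in> B" "module.independent (\<lambda>r x. real_of_int r * x) B"
    "D > (0::int)" "\<And>x. x \<in> \<Theta> \<Longrightarrow> of_int D * x = (\<Sum>b\<in>B. of_int (C x b :: int) * b)"
proof -
  interpret Modules.module "\<lambda>r. (*) (real_of_int r)"
    by (simp add: Modules.module.intro distrib_left mult.commute)
  \<comment> \<open>For this module the rule is associativity of multiplication in the direction opposite to \<open>mult.assoc\<close>,
      and the two together make simplification loop.\<close>
  note scale_scale [simp del]
  let ?P = "\<lambda>B. B \<subseteq> insert 1 \<Theta> \<and> 1 \<in> B \<and> independent B"
  have "independent {1 :: real}"
    unfolding independent_explicit_module by (simp add: subset_singleton_iff)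
  then have "?P {1}" by simp
  moreover have "\<forall>B. ?P B \<longrightarrow> card B < Suc (card (insert 1 \<Theta>))"
    using card_mono[of "insert 1 \<Theta>"] fin by (simp add: less_Suc_eq_le)
  ultimately have "\<exists>B. ?P B \<and> (\<forall>B'. ?P B' \<longrightarrow> card B' \<le> card B)"
    by (rule ex_has_greatest_nat[of ?P])
  then obtain B where B: "?P B" and max: "\<And>B'. ?P B' \<Longrightarrow> card B' \<le> card B"
    by (elim exE conjE) simp
  have finB: "finite B" using B fin finite_subset by auto
  have "\<exists>d c. d > (0::int) \<and> of_int d * x = (\<Sum>b\<in>B. of_int (c b :: int) * b)" if x: "x \<in> \<Theta>" for x
  proof (cases "x \<in> B")
    case True
    then have "x = (\<Sum>b\<in>B. of_int (if b = x then 1 else 0) * b)"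
      using finB by (simp add: if_distrib[of "\<lambda>a. a * _"] if_distrib[of of_int] cong: if_cong)
    then show ?thesis by (intro exI[of _ 1] exI[of _ "\<lambda>b. if b = x then 1 else 0"]) simp
  next
    case False
    have "\<not> independent (insert x B)"
    proof
      assume "independent (insert x B)"
      then have "card (insert x B) \<le> card B" using B x by (intro max) auto
      with False finB show False by simp
    qed
    then obtain t c v where t: "finite t" "t \<subseteq> insert x B" "(\<Sum>v\<in>t. of_int (c v) * v) = 0" "v \<in> t" "c v \<noteq> 0"
      unfolding independent_explicit_module by blast
    define e where "e = (\<lambda>b. if b \<in> t then c b else 0)"
    have "(\<Sum>b\<in>insert x B. of_int (e b) * b) = (\<Sum>v\<in>t. of_int (c v) * v)"
      using t finB by (intro sum.mono_neutral_cong_right) (auto simp: e_def)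
    then have e: "of_int (e x) * x + (\<Sum>b\<in>B. of_int (e b) * b) = 0"
      using False finB t by simp
    have "e x \<noteq> 0"
    proof
      assume ex: "e x = 0"
      then have "(\<Sum>b\<in>B. of_int (e b) * b) = 0" using e by simp
      moreover have "v \<in> B" using t ex by (auto simp: e_def split: if_splits)
      ultimately have "e v = 0"
        using B finB independentD[of B B e v] by simp
      with t show False by (simp add: e_def)
    qed
    obtain \<sigma> where \<sigma>: "\<bar>e x\<bar> = \<sigma> * e x" by (metis abs_if mult_1 mult_minus1)
    have "of_int \<bar>e x\<bar> * x = of_int \<sigma> * (of_int (e x) * x)"
      unfolding \<sigma> by simp
    also have "of_int (e x) * x = - (\<Sum>b\<in>B. of_int (e b) * b)" using e by linarith
    also have "of_int \<sigma> * \<dots> = (\<Sum>b\<in>B. of_int (- \<sigma> * e b) * b)"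
      by (simp add: sum_distrib_left sum_negf mult.assoc)
    finally show ?thesis
      using \<open>e x \<noteq> 0\<close> by (intro exI[of _ "\<bar>e x\<bar>"] exI[of _ "\<lambda>b. - \<sigma> * e b"] conjI) simp_all
  qed
  then obtain d c where d: "\<And>x. x \<in> \<Theta> \<Longrightarrow> d x > (0::int)"
    and dc: "\<And>x. x \<in> \<Theta> \<Longrightarrow> of_int (d x) * x = (\<Sum>b\<in>B. of_int (c x b :: int) * b)"
    by metis
  show thesis
  proof
    show "0 < (\<Prod>x\<in>\<Theta>. d x)" using d by (intro prod_pos) auto
    fix x assume x: "x \<in> \<Theta>"
    then have "(\<Prod>x\<in>\<Theta>. d x) = d x * (\<Prod>y\<in>\<Theta>-{x}. d y)" using fin by (simp add: prod.remove)
    then have "of_int (\<Prod>x\<in>\<Theta>. d x) * x = of_int (\<Prod>y\<in>\<Theta>-{x}. d y) * (of_int (d x) * x)" by simp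
    then show "of_int (\<Prod>x\<in>\<Theta>. d x) * x = (\<Sum>b\<in>B. of_int ((\<Prod>y\<in>\<Theta>-{x}. d y) * c x b) * b)"
      by (simp add: dc[OF x] sum_distrib_left mult.assoc)
  qed (use B finB in auto)
qed

text \<open>
  A line in the torus: the basis elements other than \<open>1\<close> are steered towards \<open>N ^ i * t\<close>, and
  \<open>D * x\<close>, an integer combination of them modulo \<open>1\<close>, then follows \<open>w x * t\<close>, where \<open>w x\<close> is the value at
  \<open>N\<close> of the polynomial \<open>Q x\<close> formed by its coordinates.  Only finitely many \<open>N\<close> make two different
  polynomials among the \<open>Q x\<close> agree at \<open>N\<close>.  If \<open>Q x = Q y\<close>, then \<open>D * x\<close> and \<open>D * y\<close> differ only in
  their integer part.
\<close>

lemma kronecker_one_parameter: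
  fixes \<Theta> :: "real set"
  assumes fin: "finite \<Theta>"
  obtains w :: "real \<Rightarrow> int" and D :: int where "D > 0"
    "\<And>x y. x \<in> \<Theta> \<Longrightarrow> y \<in> \<Theta> \<Longrightarrow> w x = w y \<Longrightarrow> of_int D * (x - y) \<in> \<int>"
    "\<And>t \<epsilon>. \<epsilon> > 0 \<Longrightarrow> \<exists>k::int. \<forall>x\<in>\<Theta>. \<exists>h::int. \<bar>of_int k * x - of_int (w x) * t - of_int h\<bar> < \<epsilon>"
proof -
  obtain B C D where finB: "finite B" and one: "1 \<in> B"
    and ind: "module.independent (\<lambda>r x. real_of_int r * x) B" and D: "D > (0::int)"
    and DC: "\<And>x. x \<in> \<Theta> \<Longrightarrow> of_int D * x = (\<Sum>b\<in>B. of_int (C x b :: int) * b)"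
    by (rule finite_int_basis[OF fin]) blast
  obtain e where e: "bij_betw e {..<card (B - {1})} (B - {1})"
    using finB by (metis finite_Diff ex_bij_betw_nat_finite atLeast0LessThan)
  define r where "r = card (B - {1})"
  define \<theta> where "\<theta> = (\<lambda>i. if i < r then e i else 1)"
  have \<theta>_image: "\<theta> ` {..<r} = B - {1}" and \<theta>_inj: "inj_on \<theta> {..<r}"
    using e by (auto simp: bij_betw_def \<theta>_def r_def inj_on_def)
  have \<theta>_r: "\<theta> r = 1" by (simp add: \<theta>_def)
  have at_most: "{..r} = insert r {..<r}" by auto
  have \<theta>_image': "\<theta> ` {..r} = B" and \<theta>_inj': "inj_on \<theta> {..r}"
    unfolding at_most using \<theta>_image \<theta>_inj \<theta>_r one by auto
  have Dx: "of_int D * x = (\<Sum>i<r. of_int (C x (\<theta> i)) * \<theta> i) + of_int (C x 1)" if "x \<in> \<Theta>" for x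
  proof -
    have "of_int D * x = (\<Sum>i\<le>r. of_int (C x (\<theta> i)) * \<theta> i)"
      unfolding DC[OF that] using sum.reindex[OF \<theta>_inj', of "\<lambda>b. of_int (C x b) * b"] \<theta>_image' by simp
    then show ?thesis unfolding at_most by (simp add: \<theta>_r)
  qed
  define Q where "Q = (\<lambda>x. \<Sum>i<r. monom (C x (\<theta> i)) i)"
  have Q_coeff: "poly.coeff (Q x) i = C x (\<theta> i)" if "i < r" for x i
    using that by (simp add: Q_def coeff_sum)
  have "finite (\<Union>(x, y)\<in>{(x, y)\<in>\<Theta> \<times> \<Theta>. Q x \<noteq> Q y}. {a. poly (Q x - Q y) a = 0})"
  proof (rule finite_UN_I)
    show "finite {(x, y)\<in>\<Theta> \<times> \<Theta>. Q x \<noteq> Q y}"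
      by (rule finite_subset[of _ "\<Theta> \<times> \<Theta>"]) (use fin in auto)
    show "finite (case a of (x, y) \<Rightarrow> {a. poly (Q x - Q y) a = 0})"
      if "a \<in> {(x, y)\<in>\<Theta> \<times> \<Theta>. Q x \<noteq> Q y}" for a
      using that poly_roots_finite[of "Q (fst a) - Q (snd a)"] by (simp add: case_prod_beta)
  qed
  then obtain N :: int where N: "N \<notin> (\<Union>(x, y)\<in>{(x, y)\<in>\<Theta> \<times> \<Theta>. Q x \<noteq> Q y}. {a. poly (Q x - Q y) a = 0})"
    using ex_new_if_finite[OF infinite_UNIV_int] by blast
  define w where "w = (\<lambda>x. poly (Q x) N)"
  have w: "w x = (\<Sum>i<r. C x (\<theta> i) * N ^ i)" for x
    by (simp add: w_def Q_def poly_sum poly_monom)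
  show thesis
  proof
    show "D > 0" by fact
    fix x y assume xy: "x \<in> \<Theta>" "y \<in> \<Theta>" "w x = w y"
    then have "Q x = Q y" using N by (auto simp: w_def)
    then have "C x (\<theta> i) = C y (\<theta> i)" if "i < r" for i using Q_coeff[OF that] by metis
    then have "of_int D * x - of_int D * y = of_int (C x 1 - C y 1)"
      using Dx xy by simp
    then show "of_int D * (x - y) \<in> \<int>" by (simp add: right_diff_distrib)
  next
    fix t \<epsilon> :: real assume \<epsilon>: "\<epsilon> > 0"
    define K where "K = 1 + (\<Sum>x\<in>\<Theta>. \<Sum>i<r. \<bar>real_of_int (C x (\<theta> i))\<bar>)"
    have K: "K > 0" unfolding K_def by (intro add_pos_nonneg sum_nonneg) auto
    have "\<epsilon> / K > 0" using \<epsilon> K by simp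
    with ind obtain k l where kl: "\<And>i. i < r \<Longrightarrow> \<bar>of_int k * \<theta> i - of_int (l i) - of_int (N ^ i) * t\<bar> < \<epsilon> / K"
      unfolding \<theta>_image'[symmetric]
      using Kronecker_thm_2[of \<theta> r "\<epsilon> / K" "\<lambda>i. of_int (N ^ i) * t", OF _ \<theta>_inj' \<theta>_r] by blast
    show "\<exists>k::int. \<forall>x\<in>\<Theta>. \<exists>h::int. \<bar>of_int k * x - of_int (w x) * t - of_int h\<bar> < \<epsilon>"
    proof (intro exI ballI)
      fix x assume x: "x \<in> \<Theta>"
      let ?h = "k * C x 1 + (\<Sum>i<r. C x (\<theta> i) * l i)"
      have "of_int (k * D) * x = of_int k * (of_int D * x)" by simp
      then have "of_int (k * D) * x - of_int (w x) * t - of_int ?h =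
        (\<Sum>i<r. of_int (C x (\<theta> i)) * (of_int k * \<theta> i - of_int (l i) - of_int (N ^ i) * t))"
        unfolding Dx[OF x] w
        by (simp add: algebra_simps sum.distrib sum_subtractf sum_distrib_left)
      also have "\<bar>\<dots>\<bar> \<le> (\<Sum>i<r. \<bar>real_of_int (C x (\<theta> i))\<bar> * (\<epsilon> / K))"
        by (rule order_trans[OF sum_abs], rule sum_mono)
           (use kl in \<open>simp only: abs_mult lessThan_iff less_imp_le mult_left_mono abs_ge_zero\<close>)
      also have "\<dots> = (\<Sum>i<r. \<bar>real_of_int (C x (\<theta> i))\<bar>) * (\<epsilon> / K)" by (rule sum_distrib_right[symmetric])
      also have "\<dots> < K * (\<epsilon> / K)"
      proof (rule mult_strict_right_mono)
        have "(\<Sum>i<r. \<bar>real_of_int (C x (\<theta> i))\<bar>) \<le> (\<Sum>x\<in>\<Theta>. \<Sum>i<r. \<bar>real_of_int (C x (\<theta> i))\<bar>)"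
          using x fin by (intro member_le_sum) (auto intro!: sum_nonneg)
        then show "(\<Sum>i<r. \<bar>real_of_int (C x (\<theta> i))\<bar>) < K" by (simp add: K_def)
      qed (use \<epsilon> K in simp)
      also have "\<dots> = \<epsilon>" using K by simp
      finally show "\<bar>of_int (k * D) * x - of_int (w x) * t - of_int ?h\<bar> < \<epsilon>" .
    qed
  qed
qed

lemma cmod_cis_diff_le: "cmod (cis a - cis b) \<le> \<bar>a - b\<bar>"
proof -
  have "cis a = cis b * exp (\<i> * (a - b))"
    by (simp add: cis_mult flip: cis_conv_exp of_real_diff)
  then have "cis a - cis b = cis b * (exp (\<i> * (a - b)) - 1)"
    by (simp add: right_diff_distrib)
  then have "cmod (cis a - cis b) = cmod (exp (\<i> * (a - b)) - 1)" by (simp add: norm_mult)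
  also have "\<dots> \<le> cmod (\<i> * (a - b))" by (rule norm_exp_minus_one_le) simp
  also have "\<dots> = \<bar>a - b\<bar>" by (simp add: norm_mult flip: of_real_diff)
  finally show ?thesis .
qed

text \<open>
  The multiplicative form of the previous lemma.  The exponent \<open>k\<close> depends on \<open>t\<close> and \<open>\<epsilon>\<close>, but the
  frequencies \<open>w z\<close> do not.
\<close>

lemma powers_approximate_characters:
  assumes fin: "finite Z" and unit: "\<And>z. z \<in> Z \<Longrightarrow> cmod z = 1"
  obtains w :: "complex \<Rightarrow> int" where
    "\<And>x y. x \<in> Z \<Longrightarrow> y \<in> Z \<Longrightarrow> w x = w y \<Longrightarrow> root_of_unity (x / y)"
    "\<And>t \<epsilon>. \<epsilon> > 0 \<Longrightarrow> \<exists>k::int. \<forall>z\<in>Z. cmod (z powi k - character (w z) t) < \<epsilon>"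
proof -
  define \<theta> where "\<theta> = (\<lambda>z. Arg z / (2 * pi))"
  have z: "z = cis (2 * pi * \<theta> z)" if "z \<in> Z" for z
    using unit[OF that] rcis_cmod_Arg[of z] by (simp add: \<theta>_def rcis_def)
  obtain w D where D: "D > (0::int)"
    and w1: "\<And>x y. x \<in> \<theta> ` Z \<Longrightarrow> y \<in> \<theta> ` Z \<Longrightarrow> w x = w y \<Longrightarrow> of_int D * (x - y) \<in> \<int>"
    and w2: "\<And>t \<epsilon>. \<epsilon> > 0 \<Longrightarrow>
      \<exists>k::int. \<forall>x\<in>\<theta> ` Z. \<exists>h::int. \<bar>of_int k * x - of_int (w x) * t - of_int h\<bar> < \<epsilon>"
    by (rule kronecker_one_parameter[OF finite_imageI[OF fin, of \<theta>]]) blast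
  show thesis
  proof
    fix x y assume xy: "x \<in> Z" "y \<in> Z" "w (\<theta> x) = w (\<theta> y)"
    then obtain h :: int where h: "of_int D * (\<theta> x - \<theta> y) = of_int h"
      using w1[of "\<theta> x" "\<theta> y"] by (auto elim: Ints_cases)
    have "x / y = cis (2 * pi * (\<theta> x - \<theta> y))"
      by (subst z[OF xy(1)], subst z[OF xy(2)]) (simp add: cis_divide right_diff_distrib)
    then have "(x / y) ^ nat D = cis (2 * pi * (of_int D * (\<theta> x - \<theta> y)))"
      using D by (simp add: Complex.DeMoivre mult_ac)
    also have "\<dots> = 1" unfolding h by (rule cis_multiple_2pi) auto
    finally show "root_of_unity (x / y)"
      unfolding root_of_unity_def using D by (intro exI[of _ "nat D"]) auto
  next
    fix t \<epsilon> :: real assume "\<epsilon> > 0"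
    then have "\<epsilon> / (2 * pi) > 0" by simp
    from w2[OF this, of t] obtain k :: int where
      k: "\<And>z. z \<in> Z \<Longrightarrow> \<exists>h::int. \<bar>of_int k * \<theta> z - of_int (w (\<theta> z)) * t - of_int h\<bar> < \<epsilon> / (2 * pi)"
      by blast
    have "cmod (z powi k - character (w (\<theta> z)) t) < \<epsilon>" if zZ: "z \<in> Z" for z
    proof -
      obtain h :: int where h: "\<bar>of_int k * \<theta> z - of_int (w (\<theta> z)) * t - of_int h\<bar> < \<epsilon> / (2 * pi)"
        using k[OF zZ] by blast
      have "z powi k = cis (of_int k * (2 * pi * \<theta> z))"
        by (subst z[OF zZ]) (rule cis_power_int)
      moreover have "character (w (\<theta> z)) t = cis (2 * pi * (of_int (w (\<theta> z)) * t + of_int h))"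
      proof -
        have "cis (2 * pi * of_int h) = 1" by (rule cis_multiple_2pi) auto
        moreover have "cis (2 * pi * (of_int (w (\<theta> z)) * t + of_int h))
            = character (w (\<theta> z)) t * cis (2 * pi * of_int h)"
          by (simp add: character_def cis_mult distrib_left mult.assoc)
        ultimately show ?thesis by simp
      qed
      ultimately have "cmod (z powi k - character (w (\<theta> z)) t)
          \<le> \<bar>of_int k * (2 * pi * \<theta> z) - 2 * pi * (of_int (w (\<theta> z)) * t + of_int h)\<bar>"
        by (simp only: cmod_cis_diff_le)
      also have "\<dots> = 2 * pi * \<bar>of_int k * \<theta> z - of_int (w (\<theta> z)) * t - of_int h\<bar>"
      proof -
        have "of_int k * (2 * pi * \<theta> z) - 2 * pi * (of_int (w (\<theta> z)) * t + of_int h)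
           = 2 * pi * (of_int k * \<theta> z - of_int (w (\<theta> z)) * t - of_int h)"
          by (simp add: algebra_simps)
        then show ?thesis by (simp add: abs_mult)
      qed
      also have "\<dots> < \<epsilon>" using h by (simp add: field_simps)
      finally show ?thesis .
    qed
    then show "\<exists>k::int. \<forall>z\<in>Z. cmod (z powi k - character (w (\<theta> z)) t) < \<epsilon>" by blast
  qed
qed

section \<open>The infimum of the power sums\<close>

theorem theorem3:
  fixes n :: nat and b z :: "nat \<Rightarrow> complex"
  assumes "n \<ge> 1"
    and "\<And>i. i \<in> {1..n} \<Longrightarrow> b i \<noteq> 0"
    and "\<And>i. i \<in> {1..n} \<Longrightarrow> b (n + 1 - i) = cnj (b i)"
    and "inj_on z {1..n}"
    and "\<And>i. i \<in> {1..n} \<Longrightarrow> cmod (z i) = 1"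
    and "\<And>i. i \<in> {1..n} \<Longrightarrow> z i \<noteq> 1"
    and "\<And>i. i \<in> {1..n} \<Longrightarrow> z (n + 1 - i) = cnj (z i)"
    and "\<And>i. i \<in> {1..n} \<Longrightarrow> z i \<noteq> -1"
    and "\<And>i j. i \<in> {1..n} \<Longrightarrow> j \<in> {1..n} \<Longrightarrow> i \<noteq> j \<Longrightarrow> \<not> root_of_unity (z j / z i)"
  shows "(INF k::int. Re (power_sum n b z k))
           < - (1 / pi ^ 4) * Min ((\<lambda>j. cmod (b j)) ` {1..n}) * ln (real n)"
proof -
  define \<beta> where "\<beta> = Min ((\<lambda>j. cmod (b j)) ` {1..n})"
  have \<beta>_pos: "\<beta> > 0" and \<beta>_le: "\<And>j. j \<in> {1..n} \<Longrightarrow> \<beta> \<le> cmod (b j)"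
    using assms(1,2) by (auto simp: \<beta>_def)
  define I where "I = (INF k::int. Re (power_sum n b z k))"
  have I_le: "I \<le> Re (power_sum n b z k)" for k
    unfolding I_def by (rule cINF_lower[OF bdd_below_power_sum]) (use assms(5) in auto)
  \<comment> \<open>The point \<open>1\<close> is included because its frequency is \<open>0\<close>, so that the injectivity of the frequencies
      also shows that those of the \<open>z j\<close> are nonzero.\<close>
  have "finite (insert 1 (z ` {1..n}))" "\<And>x. x \<in> insert 1 (z ` {1..n}) \<Longrightarrow> cmod x = 1"
    using assms(5) by auto
  then obtain w where w_eq: "\<And>x y. x \<in> insert 1 (z ` {1..n}) \<Longrightarrow> y \<in> insert 1 (z ` {1..n}) \<Longrightarrow>
        w x = w y \<Longrightarrow> root_of_unity (x / y)"
    and w_approx: "\<And>t \<epsilon>. \<epsilon> > 0 \<Longrightarrow>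
        \<exists>k::int. \<forall>x\<in>insert 1 (z ` {1..n}). cmod (x powi k - character (w x) t) < \<epsilon>"
    using powers_approximate_characters by metis
  have w_1: "w 1 = 0"
  proof -
    have "character (w 1) t = 1" for t
    proof (rule ccontr)
      assume "character (w 1) t \<noteq> 1"
      then show False using w_approx[of "cmod (1 - character (w 1) t)" t] by auto
    qed
    then have "character (w 1) = (\<lambda>t. 1)" by auto
    then have "mean (character (w 1)) = 1" by simp
    then show ?thesis by (simp add: mean_character split: if_splits)
  qed
  \<comment> \<open>If \<open>z j\<close> were a root of unity, so would be its ratio to its conjugate, which is another of the \<open>z i\<close>
      because \<open>1\<close> and \<open>- 1\<close> are excluded.\<close>
  have not_root: "\<not> root_of_unity (z j)" if j: "j \<in> {1..n}" for j
  proof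
    assume "root_of_unity (z j)"
    then obtain q where q: "q > 0" "z j ^ q = 1" by (auto simp: root_of_unity_def)
    define j' where "j' = n + 1 - j"
    have j': "j' \<in> {1..n}" "z j' = cnj (z j)" using j assms(7) by (auto simp: j'_def)
    then have "(z j / z j') ^ q = 1" using q by (simp add: power_divide flip: complex_cnj_power)
    then have "root_of_unity (z j / z j')" using q(1) by (auto simp: root_of_unity_def)
    then have "j' = j" using assms(9)[OF j'(1) j] by blast
    then have "z j \<in> \<real>" using j' by (simp add: Reals_cnj_iff)
    then obtain x where "z j = complex_of_real x" by (auto elim: Reals_cases)
    then show False using assms(5,6,8)[OF j] by (auto simp: abs_if split: if_splits)
  qed
  define m where "m = (\<lambda>j. w (z j))"
  have m_inj: "inj_on m {1..n}"
    using w_eq assms(9) unfolding inj_on_def m_def by (metis image_eqI insertCI)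
  have m_0: "0 \<notin> m ` {1..n}"
    using w_eq[of _ 1] w_1 not_root by (force simp: m_def)
  define c where "c = (\<lambda>k. b (the_inv_into {1..n} m k))"
  have c_m: "c (m j) = b j" if "j \<in> {1..n}" for j
    by (simp only: c_def the_inv_into_f_f[OF m_inj that])
  define p where "p = (\<lambda>t. \<Sum>k\<in>m ` {1..n}. c k * character k t)"
  have p: "p t = (\<Sum>j=1..n. b j * character (m j) t)" for t
    unfolding p_def sum.reindex[OF m_inj] by (intro sum.cong) (simp_all add: c_m)
  have approx: "\<exists>k. cmod (power_sum n b z k - p t) \<le> \<epsilon>" if "\<epsilon> > 0" for \<epsilon> t
  proof -
    define K where "K = 1 + (\<Sum>j=1..n. cmod (b j))"
    have K: "K > 0" unfolding K_def by (intro add_pos_nonneg sum_nonneg) auto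
    then have "\<epsilon> / K > 0" using that by simp
    then obtain k where k: "\<And>j. j \<in> {1..n} \<Longrightarrow> cmod (z j powi k - character (m j) t) < \<epsilon> / K"
      using w_approx[of "\<epsilon> / K" t] unfolding m_def by blast
    have "power_sum n b z k - p t = (\<Sum>j=1..n. b j * (z j powi k - character (m j) t))"
      by (simp add: power_sum_def p right_diff_distrib sum_subtractf)
    also have "cmod \<dots> \<le> (\<Sum>j=1..n. cmod (b j) * (\<epsilon> / K))"
    proof (rule sum_norm_le)
      fix j assume "j \<in> {1..n}"
      from mult_left_mono[OF less_imp_le[OF k[OF this]], of "cmod (b j)"]
      show "cmod (b j * (z j powi k - character (m j) t)) \<le> cmod (b j) * (\<epsilon> / K)"
        by (simp only: norm_mult norm_ge_zero)
    qed
    also have "\<dots> = (K - 1) * (\<epsilon> / K)" unfolding K_def by (subst sum_distrib_right[symmetric]) simp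
    also have "\<dots> \<le> \<epsilon>" using K that by (simp add: field_simps)
    finally show ?thesis by blast
  qed
  have p_lower: "- (- I) \<le> Re (p t)" for t
  proof (rule field_le_epsilon)
    fix \<epsilon> :: real assume "\<epsilon> > 0"
    then obtain k where "cmod (power_sum n b z k - p t) \<le> \<epsilon>" using approx by blast
    with abs_Re_le_cmod[of "power_sum n b z k - p t"] I_le[of k]
    show "- (- I) \<le> Re (p t) + \<epsilon>" by simp
  qed
  have p_real: "Im (p t) = 0" for t
  proof -
    have "\<bar>Im (p t)\<bar> \<le> 0"
    proof (rule field_le_epsilon)
      fix \<epsilon> :: real assume "\<epsilon> > 0"
      then obtain k where k: "cmod (power_sum n b z k - p t) \<le> \<epsilon>" using approx by blast
      have "power_sum n b z k \<in> \<real>" by (rule power_sum_in_Reals) (use assms(3,7) in auto)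
      then have "Im (power_sum n b z k) = 0" by (simp add: complex_is_Real_iff)
      with k abs_Im_le_cmod[of "power_sum n b z k - p t"]
      show "\<bar>Im (p t)\<bar> \<le> 0 + \<epsilon>" by simp
    qed
    then show ?thesis by simp
  qed
  obtain l where l: "(\<Sum>i\<le>l. 4 ^ i) \<le> n" "ln (real n) \<le> 14 / 5 * real (Suc l)"
    using ln_le_block_count[OF assms(1)] .
  have "\<beta> * real (Suc l) \<le> 20 * (- I)"
  proof (rule trig_poly_min_bound[of "m ` {1..n}" \<beta> c l "- I"])
    show "(\<Sum>i\<le>l. 4 ^ i) \<le> card (m ` {1..n})" using l(1) by (subst card_image[OF m_inj]) simp
    show "Im (\<Sum>k\<in>m ` {1..n}. c k * character k t) = 0" for t
      using p_real[of t] by (simp only: p_def)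
    show "- (- I) \<le> Re (\<Sum>k\<in>m ` {1..n}. c k * character k t)" for t
      using p_lower[of t] by (simp only: p_def)
  qed (use m_0 \<beta>_pos \<beta>_le c_m in auto)
  moreover have "1 / pi ^ 4 * \<beta> * ln (real n) < \<beta> * real (Suc l) / 20"
  proof -
    have "(3::real) ^ 4 \<le> pi ^ 4" using pi_gt3 by (intro power_mono) auto
    then have "1 / pi ^ 4 \<le> 1 / 81" by (intro divide_left_mono) auto
    then have "1 / pi ^ 4 * \<beta> * ln (real n) \<le> 1 / 81 * \<beta> * (14 / 5 * real (Suc l))"
      using \<beta>_pos l(2) assms(1) by (intro mult_mono) auto
    also have "\<dots> = 14 / 405 * (\<beta> * real (Suc l))" by simp
    also have "\<dots> < \<beta> * real (Suc l) / 20"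
    proof -
      have "0 < \<beta> * real (Suc l)" using \<beta>_pos by (intro mult_pos_pos) auto
      then show ?thesis by linarith
    qed
    finally show ?thesis .
  qed
  ultimately have "I < - (1 / pi ^ 4 * \<beta> * ln (real n))" by linarith
  then show ?thesis by (simp add: I_def \<beta>_def)
qed

end
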